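(* Let $A$ be a commutative associative algebra over a field $\mathbf{k}$, let $n>1$, let $D_1,\ldots,D_n$ be derivations of $A$, and let $\{-,-\}$ be a derived operation on $A$ defined using $D_1,\ldots,D_n$. Then $\{-,-\}$ satisfies a standard identity: there exists $d>0$ such that $$s_{d,l}^{\{-,-\}}(a_1,\ldots,a_d)=s_{d,r}^{\{-,-\}}(a_1,\ldots,a_d)=0$$ for all $a_1,\ldots,a_d\in A$. In fact, one can take $d=1+\frac{n^{p+1}-1}{n-1}$ for any integer $p\ge m+1$, where $m$ is the $D$-order of $\{-,-\}$.
   Context: Let $\mathfrak{g}$ be the Lie subalgebra of $\mathrm{Der}(A)$ generated by $D_1,\ldots,D_n$. Its universal enveloping algebra $U(\mathfrak{g})$ is generated by $D_1,\ldots,D_n$ and acts on $A$ by linear operators (a product of elements of $\mathfrak g$ acts as the composition of the corresponding derivations, and $1$ acts as the identity). Derived operation: a bilinear operation on $A$ of the form $$\{a,b\}:=\sum_{j=1}^s f_j(a)\, g_j(b),$$ where $f_1,g_1,\ldots,f_s,g_s$ are linear combinations of iterations of the derivations $D_1,\ldots,D_n$ (the empty iteration, i.e. the identity map, is allowed), regarded as given elements of $U(\mathfrak g)$. $D$-order: let $G^\bullet U(\mathfrak{g})$ be the filtration of $U(\mathfrak g)$ determined by $G^0U(\mathfrak{g})=\mathbf{k}1$, $G^1U(\mathfrak{g})=\mathbf{k}1\oplus \mathrm{span}_{\mathbf k}\{D_1,\ldots,D_n\}$, $G^kU(\mathfrak{g})\,G^lU(\mathfrak{g})\subset G^{k+l}U(\mathfrak{g})$;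 that is, $G^kU(\mathfrak g)$ is the span of all products of at most $k$ of the elements $D_1,\ldots,D_n$. If the derived operation is given by the formula above with $f_j\in G^{n_j}U(\mathfrak{g})$ and $g_j\in G^{m_j}U(\mathfrak{g})$, its $D$-order is $\max_j(n_j+m_j)$. Standard polynomials: for a bilinear operation $\{-,-\}$ on $A$, $$s_{d,l}^{\{-,-\}}(a_1,\ldots,a_d):=\sum_{\sigma\in S_{d-1}}(-1)^{\sigma}\{a_{\sigma(1)},\{a_{\sigma(2)},\{\ldots,\{a_{\sigma(d-2)},\{a_{\sigma(d-1)},a_d\}\}\ldots\}\}\},$$ $$s_{d,r}^{\{-,-\}}(a_1,\ldots,a_d):=\sum_{\sigma\in S_{d-1}}(-1)^{\sigma}\{\{\{\ldots\{\{a_d,a_{\sigma(d-1)}\},a_{\sigma(d-2)}\},\ldots\},a_{\sigma(2)}\},a_{\sigma(1)}\},$$ where $(-1)^\sigma$ is the sign of the permutation $\sigma$. *)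

theory Defs
  imports Complex_Main "HOL-Library.Poly_Mapping" "HOL-Combinatorics.Permutations"
begin

section \<open>Commutative algebras and derivations\<close>

text \<open>The class \<^class>\<open>comm_ring\<close> does not require a unit, so algebras are not assumed unital.\<close>

locale comm_assoc_algebra = vector_space scale
  for scale :: "'k::field \<Rightarrow> 'a::comm_ring \<Rightarrow> 'a" +
  assumes scale_mult_left: "scale c (x * y) = scale c x * y"

definition derivation :: "('k::field \<Rightarrow> 'a::comm_ring \<Rightarrow> 'a) \<Rightarrow> ('a \<Rightarrow> 'a) \<Rightarrow> bool" where
  "derivation scale D \<longleftrightarrow>
     Vector_Spaces.linear scale scale D \<and> (\<forall>a b. D (a * b) = D a * b + a * D b)"

definition commutator :: "('a::comm_ring \<Rightarrow> 'a) \<Rightarrow> ('a \<Rightarrow> 'a) \<Rightarrow> 'a \<Rightarrow> 'a" where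
  "commutator x y = (\<lambda>a. x (y a) - y (x a))"

inductive_set lie_generated ::
    "('k::field \<Rightarrow> 'a::comm_ring \<Rightarrow> 'a) \<Rightarrow> ('a \<Rightarrow> 'a) set \<Rightarrow> ('a \<Rightarrow> 'a) set"
  for scale :: "'k::field \<Rightarrow> 'a::comm_ring \<Rightarrow> 'a" and S :: "('a \<Rightarrow> 'a) set" where
  base: "x \<in> S \<Longrightarrow> x \<in> lie_generated scale S"
| zero: "(\<lambda>a. 0) \<in> lie_generated scale S"
| add: "x \<in> lie_generated scale S \<Longrightarrow> y \<in> lie_generated scale S \<Longrightarrow>
    (\<lambda>a. x a + y a) \<in> lie_generated scale S"
| scale: "x \<in> lie_generated scale S \<Longrightarrow> (\<lambda>a. scale c (x a)) \<in> lie_generated scale S"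
| bracket: "x \<in> lie_generated scale S \<Longrightarrow> y \<in> lie_generated scale S \<Longrightarrow>
    commutator x y \<in> lie_generated scale S"

section \<open>Free associative algebras\<close>

text \<open>
  Words are wrapped in a type of their own to obtain a \<^class>\<open>monoid_add\<close> under concatenation;
  then \<open>'b word \<Rightarrow>\<^sub>0 'k\<close> with its library multiplication (convolution) is the free unital
  associative \<open>'k\<close>-algebra on the letters of type \<open>'b\<close>.
\<close>

datatype 'b word = Word (letters: "'b list")

instantiation word :: (type) monoid_add
begin

definition zero_word :: "'a word" where "0 = Word []"

definition plus_word :: "'a word \<Rightarrow> 'a word \<Rightarrow> 'a word" where
  "v + w = Word (letters v @ letters w)"

instance by standard (simp_all add: zero_word_def plus_word_def)

end

definition free_algebra :: "'b set \<Rightarrow> ('b word \<Rightarrow>\<^sub>0 'k::field) set" where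
  "free_algebra L = {t. \<forall>w\<in>Poly_Mapping.keys t. set (letters w) \<subseteq> L}"

definition gen :: "'b \<Rightarrow> ('b word \<Rightarrow>\<^sub>0 'k::field)" where
  "gen x = Poly_Mapping.single (Word [x]) 1"

section \<open>The universal enveloping algebra of a Lie algebra of linear operators\<close>

text \<open>
  The enveloping algebra of a Lie algebra \<open>L\<close> of operators is the free associative algebra on the
  set \<open>L\<close> modulo the two-sided ideal expressing that \<^const>\<open>gen\<close> is linear on \<open>L\<close> (which yields the
  tensor algebra) and turns the Lie bracket into the commutator. Closure of the ideal under
  subtraction and scalar multiplication is contained in the rule \<open>mult\<close>. Elements of the
  enveloping algebra are residue classes.
\<close>

inductive_set enveloping_ideal ::
    "('k::field \<Rightarrow> 'a::comm_ring \<Rightarrow> 'a) \<Rightarrow> ('a \<Rightarrow> 'a) set \<Rightarrow> (('a \<Rightarrow> 'a) word \<Rightarrow>\<^sub>0 'k) set"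
  for scale :: "'k::field \<Rightarrow> 'a::comm_ring \<Rightarrow> 'a" and L :: "('a \<Rightarrow> 'a) set" where
  gen_add: "x \<in> L \<Longrightarrow> y \<in> L \<Longrightarrow>
    gen (\<lambda>a. x a + y a) - (gen x + gen y) \<in> enveloping_ideal scale L"
| gen_scale: "x \<in> L \<Longrightarrow>
    gen (\<lambda>a. scale c (x a)) - Poly_Mapping.single 0 c * gen x \<in> enveloping_ideal scale L"
| gen_bracket: "x \<in> L \<Longrightarrow> y \<in> L \<Longrightarrow>
    gen x * gen y - gen y * gen x - gen (commutator x y) \<in> enveloping_ideal scale L"
| add: "p \<in> enveloping_ideal scale L \<Longrightarrow> q \<in> enveloping_ideal scale L \<Longrightarrow>
    p + q \<in> enveloping_ideal scale L"
| mult: "p \<in> enveloping_ideal scale L \<Longrightarrow> t \<in> free_algebra L \<Longrightarrow> t' \<in> free_algebra L \<Longrightarrow>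
    t * p * t' \<in> enveloping_ideal scale L"

type_synonym ('k, 'a) env = "(('a \<Rightarrow> 'a) word \<Rightarrow>\<^sub>0 'k) set"

definition env_class ::
    "('k::field \<Rightarrow> 'a::comm_ring \<Rightarrow> 'a) \<Rightarrow> ('a \<Rightarrow> 'a) set \<Rightarrow>
     (('a \<Rightarrow> 'a) word \<Rightarrow>\<^sub>0 'k) \<Rightarrow> ('k, 'a) env" where
  "env_class scale L t = {t' \<in> free_algebra L. t' - t \<in> enveloping_ideal scale L}"

definition free_act ::
    "('k::field \<Rightarrow> 'a::comm_ring \<Rightarrow> 'a) \<Rightarrow> (('a \<Rightarrow> 'a) word \<Rightarrow>\<^sub>0 'k) \<Rightarrow> 'a \<Rightarrow> 'a" where
  "free_act scale t a =
     (\<Sum>w\<in>Poly_Mapping.keys t. scale (Poly_Mapping.lookup t w) (foldr (\<lambda>x b. x b) (letters w) a))"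

text \<open>
  The result does not depend on the chosen representative, see \<open>env_act_class\<close> below.
\<close>

definition env_act ::
    "('k::field \<Rightarrow> 'a::comm_ring \<Rightarrow> 'a) \<Rightarrow> ('k, 'a) env \<Rightarrow> 'a \<Rightarrow> 'a" where
  "env_act scale u = free_act scale (SOME t. t \<in> u)"

section \<open>Derived operations and their order\<close>

text \<open>
  The span of the products of at most \<open>k\<close> of the elements \<open>D 1, \<dots>, D n\<close> in the enveloping algebra
  of the Lie algebra generated by \<open>D 1, \<dots>, D n\<close>.
\<close>

definition env_filtration ::
    "('k::field \<Rightarrow> 'a::comm_ring \<Rightarrow> 'a) \<Rightarrow> nat \<Rightarrow> (nat \<Rightarrow> 'a \<Rightarrow> 'a) \<Rightarrow> nat \<Rightarrow> ('k, 'a) env set" where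
  "env_filtration scale n D k =
     env_class scale (lie_generated scale (D ` {1..n})) `
       {t \<in> free_algebra (D ` {1..n}). \<forall>w\<in>Poly_Mapping.keys t. length (letters w) \<le> k}"

definition derived_operation ::
    "('k::field \<Rightarrow> 'a::comm_ring \<Rightarrow> 'a) \<Rightarrow> nat \<Rightarrow> (nat \<Rightarrow> ('k, 'a) env) \<Rightarrow> (nat \<Rightarrow> ('k, 'a) env) \<Rightarrow>
     'a \<Rightarrow> 'a \<Rightarrow> 'a" where
  "derived_operation scale s f g a b =
     (\<Sum>j=1..s. env_act scale (f j) a * env_act scale (g j) b)"

text \<open>
  The order is attached to a presentation of the operation and to bounds \<open>N j\<close>, \<open>M j\<close> on the
  filtration degrees of \<open>f j\<close>, \<open>g j\<close>; hence a relation. The least possible bounds give the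
  smallest order.
\<close>

definition has_D_order ::
    "('k::field \<Rightarrow> 'a::comm_ring \<Rightarrow> 'a) \<Rightarrow> nat \<Rightarrow> (nat \<Rightarrow> 'a \<Rightarrow> 'a) \<Rightarrow>
     nat \<Rightarrow> (nat \<Rightarrow> ('k, 'a) env) \<Rightarrow> (nat \<Rightarrow> ('k, 'a) env) \<Rightarrow> nat \<Rightarrow> bool" where
  "has_D_order scale n D s f g m \<longleftrightarrow>
     (\<exists>N M. (\<forall>j\<in>{1..s}. f j \<in> env_filtration scale n D (N j) \<and>
                        g j \<in> env_filtration scale n D (M j)) \<and>
            m = Max ((\<lambda>j. N j + M j) ` {1..s}))"

section \<open>Standard polynomials\<close>

definition std_left ::
    "('k::field \<Rightarrow> 'a::comm_ring \<Rightarrow> 'a) \<Rightarrow> ('a \<Rightarrow> 'a \<Rightarrow> 'a) \<Rightarrow> nat \<Rightarrow> (nat \<Rightarrow> 'a) \<Rightarrow> 'a" where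
  "std_left scale br d a =
     (\<Sum>\<sigma> | \<sigma> permutes {1..d-1}.
        scale (of_int (sign \<sigma>)) (foldr (\<lambda>i b. br (a (\<sigma> i)) b) [1..<d] (a d)))"

definition std_right ::
    "('k::field \<Rightarrow> 'a::comm_ring \<Rightarrow> 'a) \<Rightarrow> ('a \<Rightarrow> 'a \<Rightarrow> 'a) \<Rightarrow> nat \<Rightarrow> (nat \<Rightarrow> 'a) \<Rightarrow> 'a" where
  "std_right scale br d a =
     (\<Sum>\<sigma> | \<sigma> permutes {1..d-1}.
        scale (of_int (sign \<sigma>)) (foldr (\<lambda>i b. br b (a (\<sigma> i))) [1..<d] (a d)))"

section \<open>The action of the enveloping algebra is well defined\<close>

context comm_assoc_algebra
begin

lemma free_act_superset:
  assumes "finite W" "Poly_Mapping.keys t \<subseteq> W"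
  shows "free_act scale t a =
    (\<Sum>w\<in>W. scale (Poly_Mapping.lookup t w) (foldr (\<lambda>x b. x b) (letters w) a))"
  unfolding free_act_def
  by (rule sum.mono_neutral_left) (use assms in \<open>auto simp: in_keys_iff\<close>)

lemma free_act_add: "free_act scale (s + t) a = free_act scale s a + free_act scale t a"
proof -
  let ?W = "Poly_Mapping.keys s \<union> Poly_Mapping.keys t"
  have W: "finite ?W" "Poly_Mapping.keys (s + t) \<subseteq> ?W" "Poly_Mapping.keys s \<subseteq> ?W" "Poly_Mapping.keys t \<subseteq> ?W"
    using Poly_Mapping.keys_add[of s t] by auto
  show ?thesis
    by (simp add: free_act_superset[OF W(1,2)] free_act_superset[OF W(1,3)]
        free_act_superset[OF W(1,4)] lookup_add scale_left_distrib sum.distrib)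
qed

lemma free_act_zero: "free_act scale 0 a = 0"
  by (simp add: free_act_def)

lemma free_act_diff: "free_act scale (s - t) a = free_act scale s a - free_act scale t a"
  using free_act_add[of "s - t" t a] by simp

lemma free_act_sum: "free_act scale (\<Sum>i\<in>I. h i) a = (\<Sum>i\<in>I. free_act scale (h i) a)"
  by (induction I rule: infinite_finite_induct) (simp_all add: free_act_add free_act_zero)

lemma free_act_single:
  "free_act scale (Poly_Mapping.single w c) a = scale c (foldr (\<lambda>x b. x b) (letters w) a)"
  by (subst free_act_superset[where W = "{w}"]) (auto simp: lookup_single)

lemma monomials_sum: "(\<Sum>w\<in>Poly_Mapping.keys t. Poly_Mapping.single w (Poly_Mapping.lookup t w)) = t"
  by (rule poly_mapping_eqI)
     (simp add: lookup_sum lookup_single when_def in_keys_iff sum.delta')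

lemma linear_word:
  assumes "\<And>x. x \<in> set xs \<Longrightarrow> Vector_Spaces.linear scale scale x"
  shows "Vector_Spaces.linear scale scale (foldr (\<lambda>x b. x b) xs)"
  using assms
proof (induction xs)
  case Nil
  then show ?case by (simp add: linear_id[unfolded id_def] id_def linear_ident)
next
  case (Cons x xs)
  then have "Vector_Spaces.linear scale scale (x \<circ> foldr (\<lambda>x b. x b) xs)"
    by (intro Vector_Spaces.linear_compose[of scale scale _ scale]) auto
  then show ?case by (simp add: o_def)
qed

lemma free_act_mult:
  assumes s: "s \<in> free_algebra L" and L: "\<And>x. x \<in> L \<Longrightarrow> Vector_Spaces.linear scale scale x"
  shows "free_act scale (s * t) a = free_act scale s (free_act scale t a)"
proof -
  let ?S = "\<lambda>t w. Poly_Mapping.single w (Poly_Mapping.lookup t w)"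
  let ?e = "\<lambda>w. foldr (\<lambda>x b. x b) (letters w)"
  have "s * t = (\<Sum>v\<in>Poly_Mapping.keys s. ?S s v) * (\<Sum>w\<in>Poly_Mapping.keys t. ?S t w)"
    by (simp only: monomials_sum)
  also have "\<dots> = (\<Sum>v\<in>Poly_Mapping.keys s. \<Sum>w\<in>Poly_Mapping.keys t. ?S s v * ?S t w)"
    by (simp add: sum_product)
  finally have "free_act scale (s * t) a = (\<Sum>v\<in>Poly_Mapping.keys s. \<Sum>w\<in>Poly_Mapping.keys t.
      scale (Poly_Mapping.lookup s v) (scale (Poly_Mapping.lookup t w) (?e v (?e w a))))"
    by (simp add: free_act_sum mult_single free_act_single plus_word_def)
  also have "\<dots> = (\<Sum>v\<in>Poly_Mapping.keys s. scale (Poly_Mapping.lookup s v) (?e v (free_act scale t a)))"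
  proof (intro sum.cong refl)
    fix v assume "v \<in> Poly_Mapping.keys s"
    then interpret ev: Vector_Spaces.linear scale scale "?e v"
      using s L by (intro linear_word) (auto simp: free_algebra_def)
    show "(\<Sum>w\<in>Poly_Mapping.keys t. scale (Poly_Mapping.lookup s v)
              (scale (Poly_Mapping.lookup t w) (?e v (?e w a)))) =
          scale (Poly_Mapping.lookup s v) (?e v (free_act scale t a))"
      by (simp add: free_act_def ev.sum ev.scale scale_sum_right)
  qed
  finally show ?thesis by (simp add: free_act_def)
qed

lemma free_algebra_add: "s \<in> free_algebra L \<Longrightarrow> t \<in> free_algebra L \<Longrightarrow> s + t \<in> free_algebra L"
  using Poly_Mapping.keys_add[of s t] by (auto simp: free_algebra_def)

lemma free_algebra_diff: "s \<in> free_algebra L \<Longrightarrow> t \<in> free_algebra L \<Longrightarrow> s - t \<in> free_algebra L"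
  using Poly_Mapping.keys_diff[of s t] by (auto simp: free_algebra_def)

lemma free_algebra_mult: "s \<in> free_algebra L \<Longrightarrow> t \<in> free_algebra L \<Longrightarrow> s * t \<in> free_algebra L"
  using Poly_Mapping.keys_mult[of s t] by (fastforce simp: free_algebra_def plus_word_def)

lemma free_algebra_gen: "x \<in> L \<Longrightarrow> gen x \<in> free_algebra L"
  by (simp add: free_algebra_def gen_def)

lemma free_algebra_const: "Poly_Mapping.single 0 c \<in> free_algebra L"
  by (simp add: free_algebra_def zero_word_def)

lemma free_act_gen: "free_act scale (gen x) a = x a"
  by (simp add: gen_def free_act_single)

lemma free_act_const: "free_act scale (Poly_Mapping.single 0 c) a = scale c a"
  by (simp add: free_act_single zero_word_def)

lemma linear_commutator:
  assumes "Vector_Spaces.linear scale scale x" "Vector_Spaces.linear scale scale y"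
  shows "Vector_Spaces.linear scale scale (commutator x y)"
proof -
  interpret x: Vector_Spaces.linear scale scale x by fact
  interpret y: Vector_Spaces.linear scale scale y by fact
  show ?thesis
    by unfold_locales
      (simp_all add: commutator_def x.add x.scale y.add y.scale scale_right_diff_distrib)
qed

lemma linear_add:
  assumes "Vector_Spaces.linear scale scale x" "Vector_Spaces.linear scale scale y"
  shows "Vector_Spaces.linear scale scale (\<lambda>a. x a + y a)"
proof -
  interpret x: Vector_Spaces.linear scale scale x by fact
  interpret y: Vector_Spaces.linear scale scale y by fact
  show ?thesis
    by unfold_locales (simp_all add: x.add x.scale y.add y.scale scale_right_distrib)
qed

lemma linear_scale:
  assumes "Vector_Spaces.linear scale scale x"
  shows "Vector_Spaces.linear scale scale (\<lambda>a. scale c (x a))"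
proof -
  interpret x: Vector_Spaces.linear scale scale x by fact
  show ?thesis
    by unfold_locales (simp_all add: x.add x.scale scale_right_distrib mult.commute)
qed

lemma enveloping_ideal_act:
  assumes L: "\<And>x. x \<in> L \<Longrightarrow> Vector_Spaces.linear scale scale x"
    and p: "p \<in> enveloping_ideal scale L"
  shows "p \<in> free_algebra {x. Vector_Spaces.linear scale scale x} \<and> (\<forall>a. free_act scale p a = 0)"
proof -
  let ?E = "{x. Vector_Spaces.linear scale scale x}"
  have act: "free_act scale (s * t) a = free_act scale s (free_act scale t a)"
    if "s \<in> free_algebra ?E" for s t a
    by (rule free_act_mult[OF that]) simp
  have sub: "t \<in> free_algebra ?E" if "t \<in> free_algebra L" for t :: "('a \<Rightarrow> 'a) word \<Rightarrow>\<^sub>0 'k"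
    using that L by (auto simp: free_algebra_def)
  note closed = free_algebra_add free_algebra_diff free_algebra_mult free_algebra_gen
    free_algebra_const
  show ?thesis
    using p
  proof (induction rule: enveloping_ideal.induct)
    case (gen_add x y)
    then show ?case
      by (auto dest: L intro!: closed linear_add simp: free_act_diff free_act_add free_act_gen)
  next
    case (gen_scale x c)
    then show ?case
      by (auto dest: L intro!: closed linear_scale
          simp: free_act_diff free_act_gen act free_act_const free_algebra_const)
  next
    case (gen_bracket x y)
    have xy: "x \<in> ?E" "y \<in> ?E" using gen_bracket L by auto
    then have "gen x * gen y - gen y * gen x - gen (commutator x y) \<in> free_algebra ?E"
      by (intro closed) (simp_all add: linear_commutator)
    moreover have "free_act scale (gen x * gen y - gen y * gen x - gen (commutator x y)) a = 0" for a
      using act[OF free_algebra_gen[OF xy(1)]] act[OF free_algebra_gen[OF xy(2)]]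
      by (simp add: free_act_diff free_act_gen commutator_def)
    ultimately show ?case by blast
  next
    case (add p q)
    then show ?case by (auto intro: closed simp: free_act_add)
  next
    case (mult p t t')
    have "free_act scale t 0 = 0"
      using act[OF sub[OF mult.hyps(2)], of 0] by (simp add: free_act_zero)
    with mult show ?case
      by (auto intro: closed sub simp: act free_algebra_mult sub)
  qed
qed

lemma env_act_class:
  assumes L: "\<And>x. x \<in> L \<Longrightarrow> Vector_Spaces.linear scale scale x"
    and t: "t \<in> free_algebra L" and "L \<noteq> {}"
  shows "env_act scale (env_class scale L t) = free_act scale t"
proof -
  obtain x where "x \<in> L" using \<open>L \<noteq> {}\<close> by blast
  from enveloping_ideal.mult[OF enveloping_ideal.gen_add[OF this this], of 0 0]
  have "0 \<in> enveloping_ideal scale L" by (simp add: free_algebra_def)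
  with t have "t \<in> env_class scale L t" by (simp add: env_class_def)
  then have "(SOME t'. t' \<in> env_class scale L t) \<in> env_class scale L t" by (rule someI)
  then have "(SOME t'. t' \<in> env_class scale L t) - t \<in> enveloping_ideal scale L"
    by (simp add: env_class_def)
  from enveloping_ideal_act[OF L this] show ?thesis
    by (auto simp: env_act_def free_act_diff)
qed

lemma linear_lie_generated:
  assumes "\<And>x. x \<in> S \<Longrightarrow> Vector_Spaces.linear scale scale x" "x \<in> lie_generated scale S"
  shows "Vector_Spaces.linear scale scale x"
  using assms(2)
proof (induction rule: lie_generated.induct)
  case zero
  show ?case by unfold_locales simp_all
qed (auto intro: assms(1) linear_add linear_scale linear_commutator)

end

end

theory Submission
  imports Defs
begin

text \<open>
  By the Leibniz rule, the nested bracket expands into monomials in which a word in the derivations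
  is applied to each argument, and the total length of the words is at most \<open>(d - 1) * m\<close>.
  Antisymmetrisation kills every monomial in which two of the \<open>d - 1\<close> permuted arguments carry the
  same word. Now \<open>d - 1\<close> is the number of words of length at most \<open>p\<close> in \<open>n\<close> letters, so \<open>d - 1\<close>
  distinct words have total length greater than \<open>(d - 1) * (p - 1)\<close>, which is too much.
\<close>

section \<open>Counting words over a finite alphabet\<close>

lemma geometric_sum_nat_div:
  fixes n :: nat
  assumes "n > 1"
  shows "(n ^ (p + 1) - 1) div (n - 1) = (\<Sum>k\<le>p. n ^ k)"
proof -
  obtain q where q: "n = Suc q" "q > 0" using assms by (cases n) auto
  \<comment> \<open>Writing \<open>n\<close> as \<open>Suc q\<close> keeps the geometric sum formula
    free of truncated subtraction and shows that the division is exact.\<close>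
  have "n ^ (p + 1) = q * (\<Sum>k\<le>p. n ^ k) + 1"
    by (induction p) (simp_all add: q algebra_simps)
  then show ?thesis using q by simp
qed

lemma geometric_sum_nat_le_power:
  fixes n :: nat
  assumes "n > 1"
  shows "(\<Sum>k\<le>j. n ^ k) \<le> n ^ (j + 1)"
proof (induction j)
  case (Suc j)
  then have "(\<Sum>k\<le>Suc j. n ^ k) \<le> 2 * n ^ (j + 1)" by simp
  also have "\<dots> \<le> n * n ^ (j + 1)" using assms by (intro mult_right_mono) auto
  finally show ?case by simp
qed (use assms in simp)

text \<open>Layer-cake counting: the total length is the sum over \<open>j\<close> of the number of
  words longer than \<open>j\<close>. At most \<open>?N j\<close> words have length at most
  \<open>j\<close>, so each of the layers \<open>j = 0, ..., q\<close> contributes at least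
  \<open>card W - ?N j\<close>. The subtracted terms add up to less than \<open>card W\<close>, that
  is, to less than one of the \<open>q + 1\<close> layers.\<close>

lemma total_length_distinct_words:
  fixes W :: "'b list set"
  assumes n: "n > 1" and S: "finite S" "card S \<le> n"
    and W: "finite W" "\<And>w. w \<in> W \<Longrightarrow> set w \<subseteq> S" "card W = (\<Sum>k\<le>q + 1. n ^ k)"
  shows "card W * q < (\<Sum>w\<in>W. length w)"
proof -
  let ?N = "\<lambda>j. \<Sum>k\<le>j. n ^ k"
  have short: "card W \<le> card {w \<in> W. j < length w} + ?N j" for j
  proof -
    have "card {w \<in> W. length w \<le> j} \<le> card {w. set w \<subseteq> S \<and> length w \<le> j}"
      using W S by (intro card_mono finite_lists_length_le) auto
    also have "\<dots> = (\<Sum>k\<le>j. card S ^ k)" by (rule card_lists_length_le[OF S(1)])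
    also have "\<dots> \<le> ?N j" using S by (intro sum_mono power_mono) auto
    finally have "card {w \<in> W. length w \<le> j} \<le> ?N j" .
    moreover have "W = {w \<in> W. j < length w} \<union> {w \<in> W. length w \<le> j}" by auto
    then have "card W \<le> card {w \<in> W. j < length w} + card {w \<in> W. length w \<le> j}"
      by (metis card_Un_le)
    ultimately show ?thesis by linarith
  qed
  have "(\<Sum>j<q + 1. ?N j) \<le> (\<Sum>j<q + 1. n ^ (j + 1))"
    by (intro sum_mono geometric_sum_nat_le_power n)
  \<comment> \<open>After the shift, the left side is \<open>?N (q + 1)\<close> without its term
    \<open>n ^ 0 = 1\<close>; this missing term makes the inequality strict.\<close>
  also have "\<dots> < ?N (q + 1)"
    by (simp only: Suc_eq_plus1[symmetric] sum.atMost_Suc_shift lessThan_Suc_atMost) simp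
  finally have N: "(\<Sum>j<q + 1. ?N j) < card W" using W(3) by simp
  have "(q + 1) * card W \<le> (\<Sum>j<q + 1. card {w \<in> W. j < length w} + ?N j)"
    using sum_mono[of "{..<q + 1}", OF short] by simp
  also have "\<dots> = (\<Sum>j<q + 1. \<Sum>w\<in>W. if j < length w then 1 else 0) + (\<Sum>j<q + 1. ?N j)"
    using W(1) by (simp add: sum.distrib sum.If_cases Int_def)
  also have "(\<Sum>j<q + 1. \<Sum>w\<in>W. if j < length w then 1 else 0) =
      (\<Sum>w\<in>W. \<Sum>j<q + 1. if j < length w then 1 else 0)"
    by (rule sum.swap)
  also have "\<dots> \<le> (\<Sum>w\<in>W. length w)"
  proof (rule sum_mono)
    fix w
    \<comment> \<open>A word is counted once in every layer below its length, but only the first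
      \<open>q + 1\<close> layers are inspected.\<close>
    have "(\<Sum>j<q + 1. if j < length w then 1 else 0) = card ({..<q + 1} \<inter> {..<length w})"
      by (simp add: sum.If_cases lessThan_def)
    also have "\<dots> \<le> card {..<length w}" by (intro card_mono) auto
    finally show "(\<Sum>j<q + 1. if j < length w then 1 else 0) \<le> length w" by simp
  qed
  finally show ?thesis using N by (simp add: algebra_simps)
qed

section \<open>Multilinear differential monomials and polynomials\<close>

abbreviation word_act :: "('a \<Rightarrow> 'a) list \<Rightarrow> 'a \<Rightarrow> 'a" where
  "word_act \<equiv> foldr (\<lambda>x b. x b)"

text \<open>
  The last factor, with index \<open>d\<close>, is kept apart from those indexed by the list \<open>js\<close>, because
  without a unit in the algebra there is no empty product.
\<close>

definition diff_monomial ::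
    "nat list \<Rightarrow> nat \<Rightarrow> (nat \<Rightarrow> ('a \<Rightarrow> 'a) list) \<Rightarrow> (nat \<Rightarrow> 'a) \<Rightarrow> 'a::comm_ring" where
  "diff_monomial js d v a =
     foldr (\<lambda>i z. word_act (v i) (a i) * z) js (word_act (v d) (a d))"

lemma diff_monomial_cong:
  "(\<And>i. i \<in> insert d (set js) \<Longrightarrow> v i = v' i) \<Longrightarrow> diff_monomial js d v a = diff_monomial js d v' a"
  by (auto simp: diff_monomial_def intro!: foldr_cong)

text \<open>In a commutative ring the product depends only on the multiset of its factors, which
  \<open>\<tau>\<close> preserves.\<close>

lemma foldr_mult_permute:
  fixes x :: "nat \<Rightarrow> 'a::comm_ring"
  assumes "\<tau> permutes set js" "distinct js"
  shows "foldr (\<lambda>i z. x (\<tau> i) * z) js b = foldr (\<lambda>i z. x i * z) js b"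
proof -
  have "image_mset \<tau> (mset js) = mset js"
    using assms by (metis mset_set_set permutes_inj_on image_mset_mset_set permutes_image)
  then have "mset (rev (map \<tau> js)) = mset (rev js)" by simp
  then have "fold (\<lambda>i z. x i * z) (rev (map \<tau> js)) = fold (\<lambda>i z. x i * z) (rev js)"
    by (intro fold_multiset_equiv) (auto simp: fun_eq_iff mult.left_commute)
  then show ?thesis by (simp add: foldr_conv_fold fold_map rev_map o_def)
qed

text \<open>The linear span of the differential monomials of total order at most \<open>k\<close>.
  Generating it inductively reduces every claim that is linear in \<open>F\<close> to monomials. Its
  members are functions of the whole family \<open>a\<close>, so arguments can be permuted by
  composing \<open>a\<close> with a permutation.\<close>

inductive_set diff_poly ::
    "('k::field \<Rightarrow> 'a::comm_ring \<Rightarrow> 'a) \<Rightarrow> ('a \<Rightarrow> 'a) set \<Rightarrow> nat list \<Rightarrow> nat \<Rightarrow> nat \<Rightarrow>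
     ((nat \<Rightarrow> 'a) \<Rightarrow> 'a) set"
  for scale :: "'k::field \<Rightarrow> 'a::comm_ring \<Rightarrow> 'a" and S js d k where
  monomial: "(\<forall>i. set (v i) \<subseteq> S) \<Longrightarrow> (\<Sum>i\<in>insert d (set js). length (v i)) \<le> k \<Longrightarrow>
    diff_monomial js d v \<in> diff_poly scale S js d k"
| zero: "(\<lambda>a. 0) \<in> diff_poly scale S js d k"
| add: "F \<in> diff_poly scale S js d k \<Longrightarrow> G \<in> diff_poly scale S js d k \<Longrightarrow>
    (\<lambda>a. F a + G a) \<in> diff_poly scale S js d k"
| scale: "F \<in> diff_poly scale S js d k \<Longrightarrow> (\<lambda>a. scale c (F a)) \<in> diff_poly scale S js d k"

lemma diff_poly_sum:
  "(\<And>i. i \<in> I \<Longrightarrow> F i \<in> diff_poly scale S js d k) \<Longrightarrow>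
   (\<lambda>a. \<Sum>i\<in>I. F i a) \<in> diff_poly scale S js d k"
  by (induction I rule: infinite_finite_induct) (auto intro: diff_poly.intros)

lemma diff_poly_mono:
  "F \<in> diff_poly scale S js d k \<Longrightarrow> k \<le> l \<Longrightarrow> F \<in> diff_poly scale S js d l"
  by (induction rule: diff_poly.induct) (auto intro: diff_poly.intros)

section \<open>Leibniz expansion of the iterated operation\<close>

context comm_assoc_algebra
begin

lemma scale_mult_right: "scale c (x * y) = x * scale c y"
  using scale_mult_left[of c y x] by (simp add: mult.commute)

lemma diff_poly_mult_word:
  assumes "F \<in> diff_poly scale S js d k" "i \<notin> set js" "i \<noteq> d" "set u \<subseteq> S"
  shows "(\<lambda>a. word_act u (a i) * F a) \<in> diff_poly scale S (i # js) d (k + length u)"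
  using assms(1)
proof (induction rule: diff_poly.induct)
  case (monomial v)
  \<comment> \<open>Since \<open>i\<close> is a new index, its word may be overwritten without
    changing the old monomial.\<close>
  let ?v = "v(i := u)"
  have "diff_monomial js d ?v a = diff_monomial js d v a" for a
    by (rule diff_monomial_cong) (use assms in auto)
  then have "(\<lambda>a. word_act u (a i) * diff_monomial js d v a) = diff_monomial (i # js) d ?v"
    using assms by (auto simp: diff_monomial_def fun_eq_iff)
  moreover have "(\<Sum>j\<in>insert d (set js). length (?v j)) = (\<Sum>j\<in>insert d (set js). length (v j))"
    by (rule sum.cong) (use assms in auto)
  then have "(\<Sum>j\<in>insert d (set (i # js)). length (?v j)) \<le> k + length u"
    using monomial assms by (simp add: insert_commute[of d i])
  moreover have "\<forall>j. set (?v j) \<subseteq> S" using monomial assms by simp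
  ultimately show ?case by (auto intro!: diff_poly.monomial simp del: fun_upd_apply)
next
  case (add F G)
  then show ?case by (simp add: distrib_left diff_poly.add)
next
  case (scale F c)
  show ?case unfolding scale_mult_right[symmetric] by (rule diff_poly.scale) (rule scale.IH)
qed (simp add: diff_poly.zero)

text \<open>The Leibniz rule along the list: \<open>x\<close> either is prefixed to the word of the
  first factor or passes on to the remaining product. Every resulting monomial has exactly one
  letter more.\<close>

lemma derivation_diff_monomial:
  assumes "distinct js" "d \<notin> set js" "\<And>i. set (v i) \<subseteq> S" "x \<in> S" "derivation scale x"
  shows "(\<lambda>a. x (diff_monomial js d v a))
    \<in> diff_poly scale S js d ((\<Sum>i\<in>insert d (set js). length (v i)) + 1)"
  using assms(1,2)
proof (induction js)
  case Nil
  have "(\<lambda>a. x (diff_monomial [] d v a)) = diff_monomial [] d (v(d := x # v d))"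
    by (simp add: diff_monomial_def fun_eq_iff)
  moreover have "\<forall>i. set ((v(d := x # v d)) i) \<subseteq> S" using assms by simp
  ultimately show ?case by (simp add: diff_poly.monomial)
next
  case (Cons i js)
  let ?k = "\<Sum>i\<in>insert d (set js). length (v i)"
  have k: "(\<Sum>i\<in>insert d (set (i # js)). length (v i)) = ?k + length (v i)"
    using Cons.prems by (simp add: insert_commute[of d i])
  have "diff_monomial js d v \<in> diff_poly scale S js d ?k"
    using assms by (intro diff_poly.monomial) auto
  then have "(\<lambda>a. word_act (x # v i) (a i) * diff_monomial js d v a)
      \<in> diff_poly scale S (i # js) d (?k + length (x # v i))"
    using Cons.prems assms by (intro diff_poly_mult_word) auto
  moreover have "(\<lambda>a. word_act (v i) (a i) * x (diff_monomial js d v a))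
      \<in> diff_poly scale S (i # js) d (?k + 1 + length (v i))"
    using Cons assms by (intro diff_poly_mult_word) auto
  moreover have "(\<lambda>a. x (diff_monomial (i # js) d v a)) =
     (\<lambda>a. word_act (x # v i) (a i) * diff_monomial js d v a +
          word_act (v i) (a i) * x (diff_monomial js d v a))"
    using assms(5) by (simp add: derivation_def diff_monomial_def fun_eq_iff)
  ultimately show ?case unfolding k by (simp add: diff_poly.add)
qed

lemma derivation_diff_poly:
  assumes "F \<in> diff_poly scale S js d k"
    and "distinct js" "d \<notin> set js" "x \<in> S" "derivation scale x"
  shows "(\<lambda>a. x (F a)) \<in> diff_poly scale S js d (k + 1)"
proof -
  interpret x: Vector_Spaces.linear scale scale x
    using assms(5) by (simp add: derivation_def)
  show ?thesis
    using assms(1)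
  proof (induction rule: diff_poly.induct)
    case (monomial v)
    then show ?case
      using derivation_diff_monomial[OF assms(2,3) _ assms(4,5), of v] by (auto elim: diff_poly_mono)
  next
    case (scale F c)
    show ?case unfolding x.scale by (rule diff_poly.scale) (rule scale.IH)
  qed (simp_all add: x.zero x.add diff_poly.zero diff_poly.add)
qed

lemma word_act_diff_poly:
  assumes "F \<in> diff_poly scale S js d k" "distinct js" "d \<notin> set js"
    and "set u \<subseteq> S" "\<And>x. x \<in> S \<Longrightarrow> derivation scale x"
  shows "(\<lambda>a. word_act u (F a)) \<in> diff_poly scale S js d (k + length u)"
  using assms(4)
proof (induction u)
  case (Cons x u)
  then show ?case
    using derivation_diff_poly[of "\<lambda>a. word_act u (F a)" S js d "k + length u" x] assms by simp
qed (use assms in simp)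

text \<open>A word of \<open>s\<close> lands on the new argument \<open>i\<close> alone, while the
  letters of a word of \<open>t\<close> are distributed over the factors of \<open>F\<close> by the
  Leibniz rule; the lengths add up to at most \<open>l + l'\<close>.\<close>

lemma free_act_mult_diff_poly:
  assumes F: "F \<in> diff_poly scale S js d k" "distinct (i # js)" "d \<notin> set (i # js)"
    and S: "\<And>x. x \<in> S \<Longrightarrow> derivation scale x"
    and s: "s \<in> free_algebra S" "\<And>w. w \<in> Poly_Mapping.keys s \<Longrightarrow> length (letters w) \<le> l"
    and t: "t \<in> free_algebra S" "\<And>w. w \<in> Poly_Mapping.keys t \<Longrightarrow> length (letters w) \<le> l'"
  shows "(\<lambda>a. free_act scale s (a i) * free_act scale t (F a))
    \<in> diff_poly scale S (i # js) d (k + (l + l'))"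
proof -
  have "(\<lambda>a. word_act (letters w) (a i) * word_act (letters u) (F a))
      \<in> diff_poly scale S (i # js) d (k + (l + l'))"
    if "w \<in> Poly_Mapping.keys s" "u \<in> Poly_Mapping.keys t" for w u
  proof (rule diff_poly_mono)
    show "(\<lambda>a. word_act (letters w) (a i) * word_act (letters u) (F a))
      \<in> diff_poly scale S (i # js) d (k + length (letters u) + length (letters w))"
      using that s t F S
      by (intro diff_poly_mult_word word_act_diff_poly) (auto simp: free_algebra_def)
  qed (use s(2)[OF that(1)] t(2)[OF that(2)] in simp)
  \<comment> \<open>Bilinearity turns the product into a double sum over pairs of words, with both
    coefficients pulled out in front.\<close>
  then show ?thesis
    unfolding free_act_def sum_product scale_mult_left[symmetric] scale_mult_right[symmetric]
    by (intro diff_poly_sum diff_poly.scale)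
qed

text \<open>Induction on the nesting depth: each further bracket brings in one new argument and adds
  at most \<open>N j + M j \<le> m\<close> letters.\<close>

lemma iterated_operation_diff_poly:
  assumes S: "\<And>x. x \<in> S \<Longrightarrow> derivation scale x"
    and s: "\<And>j. j \<in> J \<Longrightarrow> s j \<in> free_algebra S"
      "\<And>j w. j \<in> J \<Longrightarrow> w \<in> Poly_Mapping.keys (s j) \<Longrightarrow> length (letters w) \<le> N j"
    and t: "\<And>j. j \<in> J \<Longrightarrow> t j \<in> free_algebra S"
      "\<And>j w. j \<in> J \<Longrightarrow> w \<in> Poly_Mapping.keys (t j) \<Longrightarrow> length (letters w) \<le> M j"
    and m: "\<And>j. j \<in> J \<Longrightarrow> N j + M j \<le> m"
    and br: "\<And>x y. br x y = (\<Sum>j\<in>J. free_act scale (s j) x * free_act scale (t j) y)"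
    and js: "distinct js" "d \<notin> set js"
  shows "(\<lambda>a. foldr (\<lambda>i b. br (a i) b) js (a d)) \<in> diff_poly scale S js d (length js * m)"
  using js
proof (induction js)
  case Nil
  \<comment> \<open>The innermost argument \<open>a d\<close> is the monomial all of whose words are
    empty.\<close>
  have "diff_monomial [] d (\<lambda>_. []) \<in> diff_poly scale S [] d 0"
    by (rule diff_poly.monomial) simp_all
  moreover have "diff_monomial [] d (\<lambda>_. []) = (\<lambda>a::nat \<Rightarrow> 'a. a d)"
    by (simp add: diff_monomial_def fun_eq_iff)
  ultimately show ?case by simp
next
  case (Cons i js)
  let ?F = "\<lambda>a. foldr (\<lambda>i b. br (a i) b) js (a d)"
  have "(\<lambda>a. free_act scale (s j) (a i) * free_act scale (t j) (?F a))
      \<in> diff_poly scale S (i # js) d (length js * m + (N j + M j))" if "j \<in> J" for j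
    using Cons that S s t by (intro free_act_mult_diff_poly) auto
  then have "(\<lambda>a. free_act scale (s j) (a i) * free_act scale (t j) (?F a))
      \<in> diff_poly scale S (i # js) d (length (i # js) * m)" if "j \<in> J" for j
    by (rule diff_poly_mono) (use that m[OF that] in simp_all)
  then show ?case by (simp add: br diff_poly_sum)
qed

section \<open>Antisymmetrisation\<close>

text \<open>Composition with the transposition matches even with odd permutations, and matched terms
  cancel. Splitting by parity, rather than showing that the sum is its own negative, avoids division
  by 2 and so covers characteristic 2.\<close>

lemma alternating_sum_eq_0:
  fixes h :: "('b \<Rightarrow> 'b) \<Rightarrow> 'a"
  assumes I: "finite I" "i \<in> I" "j \<in> I" "i \<noteq> j"
    and h: "\<And>\<sigma>. \<sigma> permutes I \<Longrightarrow> h (\<sigma> \<circ> transpose i j) = h \<sigma>"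
  shows "(\<Sum>\<sigma> | \<sigma> permutes I. scale (of_int (sign \<sigma>)) (h \<sigma>)) = 0"
proof -
  let ?P = "{\<sigma>. \<sigma> permutes I}" and ?\<tau> = "transpose i j"
  let ?E = "{\<sigma> \<in> ?P. evenperm \<sigma>}" and ?O = "{\<sigma> \<in> ?P. \<not> evenperm \<sigma>}"
  let ?g = "\<lambda>\<sigma>. scale (of_int (sign \<sigma>)) (h \<sigma>)"
  have \<tau>: "?\<tau> permutes I" using I by (simp add: permutes_swap_id)
  have perm: "permutation \<sigma>" if "\<sigma> permutes I" for \<sigma>
    using that I(1) by (auto simp: permutation_permutes)
  have even: "evenperm (\<sigma> \<circ> ?\<tau>) \<longleftrightarrow> \<not> evenperm \<sigma>" if "\<sigma> permutes I" for \<sigma>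
    using I(4) by (simp add: evenperm_comp perm[OF that] permutation_swap_id evenperm_swap)
  have "sum ?g ?O = (\<Sum>\<sigma>\<in>?E. - ?g \<sigma>)"
    by (rule sum.reindex_bij_witness[of _ "\<lambda>\<sigma>. \<sigma> \<circ> ?\<tau>" "\<lambda>\<sigma>. \<sigma> \<circ> ?\<tau>"])
       (auto simp: o_assoc[symmetric] even permutes_compose[OF \<tau>] h sign_def)
  moreover have "sum ?g ?P = sum ?g ?E + sum ?g ?O"
    using I(1) by (subst sum.union_disjoint[symmetric])
      (auto simp: finite_permutations intro!: sum.cong)
  ultimately show ?thesis by (simp add: sum_negf)
qed

text \<open>Because \<open>v\<close> takes the same word at \<open>i\<close> and \<open>j\<close>,
  swapping these arguments only reorders the factors of a commutative product, and the cancellation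
  in pairs applies.\<close>

lemma alternating_sum_diff_monomial_eq_0:
  assumes "i \<in> {1..<d}" "j \<in> {1..<d}" "i \<noteq> j" "v i = v j"
  shows "(\<Sum>\<sigma> | \<sigma> permutes {1..<d}.
    scale (of_int (sign \<sigma>)) (diff_monomial [1..<d] d v (a \<circ> \<sigma>))) = 0"
proof (rule alternating_sum_eq_0[of _ i j])
  fix \<sigma> :: "nat \<Rightarrow> nat"
  let ?\<tau> = "transpose i j"
  have \<tau>: "?\<tau> permutes set [1..<d]" using assms by (simp add: permutes_swap_id)
  have v: "v (?\<tau> l) = v l" for l using assms by (simp add: transpose_def)
  have d: "?\<tau> d = d" using assms by (simp add: transpose_def)
  have "diff_monomial [1..<d] d v (a \<circ> (\<sigma> \<circ> ?\<tau>)) =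
      foldr (\<lambda>l z. word_act (v (?\<tau> l)) (a (\<sigma> (?\<tau> l))) * z) [1..<d] (word_act (v d) (a (\<sigma> d)))"
    by (simp add: diff_monomial_def v d)
  also have "\<dots> = diff_monomial [1..<d] d v (a \<circ> \<sigma>)"
    using foldr_mult_permute[OF \<tau>, of "\<lambda>l. word_act (v l) (a (\<sigma> l))"]
    by (simp add: diff_monomial_def)
  finally show "diff_monomial [1..<d] d v (a \<circ> (\<sigma> \<circ> ?\<tau>)) = diff_monomial [1..<d] d v (a \<circ> \<sigma>)" .
qed (use assms in auto)

text \<open>If the \<open>d - 1\<close> permuted arguments carried distinct words, these alone would
  exceed the length budget \<open>(d - 1) * q\<close>. Hence in every monomial two of them share a
  word.\<close>

lemma alternating_sum_diff_poly_eq_0: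
  assumes "F \<in> diff_poly scale S [1..<d] d ((d - 1) * q)"
    and n: "n > 1" and S: "finite S" "card S \<le> n"
    and d: "d = 1 + (\<Sum>k\<le>q + 1. n ^ k)"
  shows "(\<Sum>\<sigma> | \<sigma> permutes {1..<d}. scale (of_int (sign \<sigma>)) (F (a \<circ> \<sigma>))) = 0"
  using assms(1)
proof (induction rule: diff_poly.induct)
  case (monomial v)
  have "\<not> inj_on v {1..<d}"
  proof
    assume inj: "inj_on v {1..<d}"
    then have "card (v ` {1..<d}) = (\<Sum>k\<le>q + 1. n ^ k)" by (simp add: card_image d)
    then have "card (v ` {1..<d}) * q < (\<Sum>w\<in>v ` {1..<d}. length w)"
      using monomial by (intro total_length_distinct_words[OF n S]) auto
    then have "(d - 1) * q < (\<Sum>i\<in>{1..<d}. length (v i))"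
      using inj by (simp add: card_image sum.reindex)
    \<comment> \<open>The budget also pays for the word at \<open>d\<close>; dropping its
      nonnegative length leaves the sum over \<open>{1..<d}\<close> within the budget.\<close>
    with monomial show False by simp
  qed
  then obtain i j where "i \<in> {1..<d}" "j \<in> {1..<d}" "i \<noteq> j" "v i = v j"
    by (auto simp: inj_on_def)
  then show ?case by (rule alternating_sum_diff_monomial_eq_0)
next
  case (add F G)
  then show ?case by (simp add: scale_right_distrib sum.distrib)
next
  case (scale F c)
  have "(\<Sum>\<sigma> | \<sigma> permutes {1..<d}. scale (of_int (sign \<sigma>)) (scale c (F (a \<circ> \<sigma>)))) =
      scale c (\<Sum>\<sigma> | \<sigma> permutes {1..<d}. scale (of_int (sign \<sigma>)) (F (a \<circ> \<sigma>)))"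
    by (simp add: scale_sum_right mult.commute)
  then show ?case by (simp only: scale.IH scale_zero_right)
qed simp

section \<open>From the enveloping algebra to the standard identities\<close>

text \<open>Trades a residue class for a representative made of short words in the
  \<open>D i\<close>. The arbitrary choice inside \<open>env_act\<close> does no harm, since by
  \<open>env_act_class\<close> all representatives act alike.\<close>

lemma env_filtration_act:
  assumes D: "\<forall>i\<in>{1..n}. derivation scale (D i)" and u: "u \<in> env_filtration scale n D k"
  shows "\<exists>t\<in>free_algebra (D ` {1..n}).
    (\<forall>w\<in>Poly_Mapping.keys t. length (letters w) \<le> k) \<and> env_act scale u = free_act scale t"
proof -
  let ?L = "lie_generated scale (D ` {1..n})"
  from u obtain t where t: "t \<in> free_algebra (D ` {1..n})"
    "\<forall>w\<in>Poly_Mapping.keys t. length (letters w) \<le> k" "u = env_class scale ?L t"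
    by (auto simp: env_filtration_def)
  have "env_act scale (env_class scale ?L t) = free_act scale t"
  proof (rule env_act_class)
    show "t \<in> free_algebra ?L"
      using t(1) by (auto simp: free_algebra_def intro: lie_generated.base)
    show "?L \<noteq> {}" using lie_generated.zero by blast
    show "Vector_Spaces.linear scale scale x" if "x \<in> ?L" for x
      using that by (rule linear_lie_generated[rotated]) (use D in \<open>auto simp: derivation_def\<close>)
  qed
  with t show ?thesis by auto
qed

text \<open>Here \<open>q\<close> stands for \<open>p - 1\<close>. Each of the \<open>d - 1\<close>
  brackets contributes order at most \<open>m \<le> q\<close>, which is exactly the budget that
  antisymmetrisation tolerates.\<close>

lemma std_left_derived_operation_eq_0:
  assumes n: "n > 1" and D: "\<forall>i\<in>{1..n}. derivation scale (D i)"
    and m: "has_D_order scale n D s f g m" "m \<le> q"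
    and d: "d = 1 + (\<Sum>k\<le>q + 1. n ^ k)"
  shows "std_left scale (derived_operation scale s f g) d a = 0"
proof -
  let ?S = "D ` {1..n}" and ?br = "derived_operation scale s f g"
  from m(1) obtain N M where NM: "\<And>j. j \<in> {1..s} \<Longrightarrow> f j \<in> env_filtration scale n D (N j)"
      "\<And>j. j \<in> {1..s} \<Longrightarrow> g j \<in> env_filtration scale n D (M j)"
      "m = Max ((\<lambda>j. N j + M j) ` {1..s})"
    unfolding has_D_order_def by blast
  have le: "N j + M j \<le> q" if "j \<in> {1..s}" for j
    using that by (intro order_trans[OF Max_ge m(2)[unfolded NM(3)]]) auto
  obtain u where u: "\<And>j. j \<in> {1..s} \<Longrightarrow> u j \<in> free_algebra ?S \<and>
      (\<forall>w\<in>Poly_Mapping.keys (u j). length (letters w) \<le> N j) \<and>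
      env_act scale (f j) = free_act scale (u j)"
    using env_filtration_act[OF D NM(1)] by metis
  obtain t where t: "\<And>j. j \<in> {1..s} \<Longrightarrow> t j \<in> free_algebra ?S \<and>
      (\<forall>w\<in>Poly_Mapping.keys (t j). length (letters w) \<le> M j) \<and>
      env_act scale (g j) = free_act scale (t j)"
    using env_filtration_act[OF D NM(2)] by metis
  let ?F = "\<lambda>a. foldr (\<lambda>i b. ?br (a i) b) [1..<d] (a d)"
  have "?F \<in> diff_poly scale ?S [1..<d] d (length [1..<d] * q)"
  proof (rule iterated_operation_diff_poly[where N = N and M = M])
    show "?br x y = (\<Sum>j\<in>{1..s}. free_act scale (u j) x * free_act scale (t j) y)" for x y
      using u t by (simp add: derived_operation_def)
  qed (use D u t le in auto)
  \<comment> \<open>Only an inequality, as some of the \<open>D i\<close> may coincide.\<close>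
  moreover have "card ?S \<le> n" using card_image_le[of "{1..n}" D] by simp
  ultimately have "(\<Sum>\<sigma> | \<sigma> permutes {1..<d}. scale (of_int (sign \<sigma>)) (?F (a \<circ> \<sigma>))) = 0"
    by (intro alternating_sum_diff_poly_eq_0[OF _ n _ _ d]) auto
  moreover have "std_left scale ?br d a =
      (\<Sum>\<sigma> | \<sigma> permutes {1..<d}. scale (of_int (sign \<sigma>)) (?F (a \<circ> \<sigma>)))"
    unfolding std_left_def
  proof (rule sum.cong)
    have "{1..d - 1} = {1..<d}" using d by auto
    then show "{\<sigma>. \<sigma> permutes {1..d - 1}} = {\<sigma>. \<sigma> permutes {1..<d}}" by simp
    fix \<sigma> assume "\<sigma> \<in> {\<sigma>. \<sigma> permutes {1..<d}}"
    \<comment> \<open>The innermost argument stays in place, so permuting indices in the nested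
      bracket is the same as evaluating it at \<open>a \<circ> \<sigma>\<close>.\<close>
    then have "\<sigma> d = d" by (auto intro: permutes_not_in)
    then show "scale (of_int (sign \<sigma>)) (foldr (\<lambda>i b. ?br (a (\<sigma> i)) b) [1..<d] (a d)) =
        scale (of_int (sign \<sigma>)) (?F (a \<circ> \<sigma>))"
      by simp
  qed
  ultimately show ?thesis by simp
qed

text \<open>By commutativity, exchanging \<open>f\<close> and \<open>g\<close> yields the opposite
  operation, whose left-nested brackets are the right-nested ones of the original.\<close>

lemma std_right_conv_std_left:
  "std_right scale (derived_operation scale s f g) = std_left scale (derived_operation scale s g f)"
  by (simp add: std_right_def std_left_def derived_operation_def mult.commute fun_eq_iff)

end

lemma has_D_order_commute:
  "has_D_order scale n D s f g m \<Longrightarrow> has_D_order scale n D s g f m"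
  unfolding has_D_order_def by (metis (no_types, lifting) add.commute image_cong)

theorem theorem2:
  fixes scale :: "'k::field \<Rightarrow> 'a::comm_ring \<Rightarrow> 'a"
    and D :: "nat \<Rightarrow> 'a \<Rightarrow> 'a"
    and f g :: "nat \<Rightarrow> ('k, 'a) env"
    and n s :: nat
  assumes "comm_assoc_algebra scale"
    and "n > 1"
    and "\<forall>i\<in>{1..n}. derivation scale (D i)"
    and "s \<ge> 1"
    and "\<forall>j\<in>{1..s}. f j \<in> (\<Union>k. env_filtration scale n D k) \<and>
                     g j \<in> (\<Union>k. env_filtration scale n D k)"
  shows "(\<exists>d>0. \<forall>a. std_left scale (derived_operation scale s f g) d a = 0 \<and>
                    std_right scale (derived_operation scale s f g) d a = 0) \<and>
    (\<forall>m p d. has_D_order scale n D s f g m \<and> p \<ge> m + 1 \<and>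
             d = 1 + (n ^ (p + 1) - 1) div (n - 1) \<longrightarrow>
       (\<forall>a. std_left scale (derived_operation scale s f g) d a = 0 \<and>
            std_right scale (derived_operation scale s f g) d a = 0))"
proof -
  interpret comm_assoc_algebra scale by fact
  have main: "std_left scale (derived_operation scale s f g) d a = 0 \<and>
      std_right scale (derived_operation scale s f g) d a = 0"
    if m: "has_D_order scale n D s f g m" and p: "p \<ge> m + 1"
      and d: "d = 1 + (n ^ (p + 1) - 1) div (n - 1)" for m p d a
  proof -
    \<comment> \<open>From \<open>p \<ge> m + 1\<close> it follows that \<open>p \<ge> 1\<close>, so
      the truncated \<open>p - 1\<close> satisfies \<open>(p - 1) + 1 = p\<close>.\<close>
    have q: "m \<le> p - 1" "d = 1 + (\<Sum>k\<le>(p - 1) + 1. n ^ k)"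
      using p d geometric_sum_nat_div[OF assms(2), of p] by simp_all
    show ?thesis
      unfolding std_right_conv_std_left
      using std_left_derived_operation_eq_0[OF assms(2,3) m q]
        std_left_derived_operation_eq_0[OF assms(2,3) has_D_order_commute[OF m] q] by simp
  qed
  \<comment> \<open>Choosing a filtration degree for each \<open>f j\<close> and \<open>g j\<close>
    shows that some order \<open>m\<close> exists; the least admissible \<open>p = m + 1\<close>
    then supplies the witness \<open>d\<close>.\<close>
  have "\<exists>N. \<forall>j\<in>{1..s}. f j \<in> env_filtration scale n D (N j)"
    "\<exists>M. \<forall>j\<in>{1..s}. g j \<in> env_filtration scale n D (M j)"
    using assms(5) by (auto intro!: bchoice)
  then obtain m where "has_D_order scale n D s f g m"
    unfolding has_D_order_def by blast
  from main[OF this order_refl refl] have "\<exists>d>0. \<forall>a.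
      std_left scale (derived_operation scale s f g) d a = 0 \<and>
      std_right scale (derived_operation scale s f g) d a = 0"
    by (intro exI[of _ "1 + (n ^ (m + 1 + 1) - 1) div (n - 1)"]) simp
  with main show ?thesis by blast
qed

end
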